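(* Let $\mathcal K$ be a marked and codotted enhanced 2-category with a codotted-lax terminal object $U$. Suppose that $(T,i,m)$ is a marked enhanced 2-monad on $\mathcal K$ such that $TU$ is codotted. Then there is an essentially unique (i.e. unique up to isomorphism) lax $T$-algebra structure on $U$ which is codotted-lax terminal in the marked and codotted enhanced 2-category $\mathrm{LaxAlg}(T)$.
   Context: An enhanced 2-category $\mathcal K$ is a 2-category, whose 1-cells are called loose (written $\rightsquigarrow$), with a wide and locally full sub-2-category whose 1-cells are called tight (written $\to$). A marking is a wide and locally full subcategory whose 1-cells are called marked. A codotting on a marked enhanced 2-category is a class of objects (a full subcategory) called codotted, such that if $B$ is codotted and $t:A\to B$ is marked and tight, then $A$ is codotted. In a marked enhanced 2-category $\mathcal E$, an object $U$ is marked-lax terminal if, explicitly: (1) every object $X$ has a chosen marked 1-cell $dX:X\rightsquigarrow U$; (2) for every $f:X\rightsquigarrow Y$ there is a unique 2-cell $df:dX\Rightarrow dY\circ f$; (3) $df$ is invertible if $f$ is marked; (4) there is an isomorphism $!_U:dU\cong\mathrm{id}_U$. If $\mathcal E$ is also codotted, $U$ is codotted-lax terminal (also called codotted-marked-lax terminal) if moreover $U$ is codotted and $dX$ is tight for every codotted $X$. An enhanced 2-monad $(T,i,m)$ is a 2-monad with $T$ preserving tight 1-cells and $i,m$ having tight components; it is marked if $T$ preserves marked 1-cells. A lax $T$-algebra is $(A,\alpha,\upsilon,\mu)$ with $\alpha:TA\to A$ tight, $\upsilon:\mathrm{id}_A\Rightarrow\alpha i_A$ and $\mu:\alpha\circ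 T\alpha\Rightarrow\alpha\circ m_A$ such that $(\mu\, i_{TA})(\upsilon\alpha)=\mathrm{id}_\alpha$, $(\mu\, Ti_A)(\alpha\, T\upsilon)=\mathrm{id}_\alpha$, $(\mu\, m_{TA})(\mu\, T^2\alpha)=(\mu\, Tm_A)(\alpha\, T\mu)$. A lax $T$-morphism $(f,\bar f):(A,\alpha)\rightsquigarrow(B,\beta)$ is a loose $f$ with $\bar f:\beta\circ Tf\Rightarrow f\circ\alpha$ such that $f\upsilon_A=(\bar f i_A)(\upsilon_B f)$ and $(f\mu_A)(\bar f\,T\alpha)(\beta\,T\bar f)=(\bar f m_A)(\mu_B\,T^2f)$; it is pseudo if $\bar f$ is invertible. A $T$-2-morphism $f\Rightarrow f'$ is a 2-cell $\varphi$ with $(\varphi\alpha)\bar f=\bar f'(\beta\,T\varphi)$. $\mathrm{LaxAlg}(T)$ (the paper's $\mathrm{Alg}^{\mathrm{lx}}_{\mathrm{lx},t\mathrm{ps}}(T)$) is the enhanced 2-category of lax $T$-algebras, lax $T$-morphisms as loose 1-cells, pseudo-$T$-morphisms with tight underlying 1-cell as tight 1-cells, and $T$-2-morphisms. It is marked at the morphisms whose underlying 1-cell is marked in $\mathcal K$, and codotted at the algebras whose carrier is codotted in $\mathcal K$ and whose structure map is marked. *)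

theory Defs
  imports Main
begin

section \<open>Enhanced, marked and codotted 2-categories\<close>

text \<open>
  Strict 2-categories with explicit carriers.  Both compositions are written in applicative order
  (\<open>g \<odot> f\<close> is \<open>f\<close> followed by \<open>g\<close>) and are only meaningful on composable cells.
\<close>

record ('o, 'm, 'c) two_cat =
  Ob :: "'o set"
  Mor :: "'m set"
  Cell :: "'c set"
  Dom :: "'m \<Rightarrow> 'o"
  Cod :: "'m \<Rightarrow> 'o"
  Id1 :: "'o \<Rightarrow> 'm"
  comp1 :: "'m \<Rightarrow> 'm \<Rightarrow> 'm"  (infixr "\<odot>\<index>" 75)
  Src :: "'c \<Rightarrow> 'm"
  Tgt :: "'c \<Rightarrow> 'm"
  Id2 :: "'m \<Rightarrow> 'c"
  vcomp :: "'c \<Rightarrow> 'c \<Rightarrow> 'c"  (infixr "\<cdot>\<index>" 65)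
  hcomp :: "'c \<Rightarrow> 'c \<Rightarrow> 'c"  (infixr "\<star>\<index>" 75)

record ('o, 'm, 'c) enhanced_two_cat = "('o, 'm, 'c) two_cat" +
  Tight :: "'m set"

record ('o, 'm, 'c) marked_two_cat = "('o, 'm, 'c) enhanced_two_cat" +
  Marked :: "'m set"

record ('o, 'm, 'c) codotted_two_cat = "('o, 'm, 'c) marked_two_cat" +
  Codotted :: "'o set"

definition hom1 :: "('o, 'm, 'c, 'x) two_cat_scheme \<Rightarrow> 'o \<Rightarrow> 'o \<Rightarrow> 'm set" where
  "hom1 K X Y = {f \<in> Mor K. Dom K f = X \<and> Cod K f = Y}"

definition hom2 :: "('o, 'm, 'c, 'x) two_cat_scheme \<Rightarrow> 'm \<Rightarrow> 'm \<Rightarrow> 'c set" where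
  "hom2 K f g = {\<phi> \<in> Cell K. Src K \<phi> = f \<and> Tgt K \<phi> = g}"

definition invertible2 :: "('o, 'm, 'c, 'x) two_cat_scheme \<Rightarrow> 'c \<Rightarrow> bool" where
  "invertible2 K \<phi> \<longleftrightarrow> \<phi> \<in> Cell K \<and>
     (\<exists>\<psi> \<in> hom2 K (Tgt K \<phi>) (Src K \<phi>).
        \<psi> \<cdot>\<^bsub>K\<^esub> \<phi> = Id2 K (Src K \<phi>) \<and> \<phi> \<cdot>\<^bsub>K\<^esub> \<psi> = Id2 K (Tgt K \<phi>))"

abbreviation lwhisker :: "('o, 'm, 'c, 'x) two_cat_scheme \<Rightarrow> 'm \<Rightarrow> 'c \<Rightarrow> 'c"
  (infixr "\<rhd>\<index>" 75) where
  "f \<rhd>\<^bsub>K\<^esub> \<phi> \<equiv> Id2 K f \<star>\<^bsub>K\<^esub> \<phi>"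

abbreviation rwhisker :: "('o, 'm, 'c, 'x) two_cat_scheme \<Rightarrow> 'c \<Rightarrow> 'm \<Rightarrow> 'c"
  (infixl "\<lhd>\<index>" 75) where
  "\<phi> \<lhd>\<^bsub>K\<^esub> f \<equiv> \<phi> \<star>\<^bsub>K\<^esub> Id2 K f"

locale two_category =
  fixes K (structure)
  assumes Dom_in: "f \<in> Mor K \<Longrightarrow> Dom K f \<in> Ob K"
    and Cod_in: "f \<in> Mor K \<Longrightarrow> Cod K f \<in> Ob K"
    and Id1_in: "X \<in> Ob K \<Longrightarrow> Id1 K X \<in> hom1 K X X"
    and comp1_in: "\<lbrakk>f \<in> hom1 K X Y; g \<in> hom1 K Y Z\<rbrakk> \<Longrightarrow> g \<odot> f \<in> hom1 K X Z"
    and comp1_Id1: "f \<in> hom1 K X Y \<Longrightarrow> f \<odot> Id1 K X = f"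
    and Id1_comp1: "f \<in> hom1 K X Y \<Longrightarrow> Id1 K Y \<odot> f = f"
    and comp1_assoc:
      "\<lbrakk>f \<in> hom1 K W X; g \<in> hom1 K X Y; h \<in> hom1 K Y Z\<rbrakk> \<Longrightarrow> (h \<odot> g) \<odot> f = h \<odot> (g \<odot> f)"
    and Src_in: "\<phi> \<in> Cell K \<Longrightarrow> Src K \<phi> \<in> Mor K"
    and Tgt_in: "\<phi> \<in> Cell K \<Longrightarrow> Tgt K \<phi> \<in> hom1 K (Dom K (Src K \<phi>)) (Cod K (Src K \<phi>))"
    and Id2_in: "f \<in> Mor K \<Longrightarrow> Id2 K f \<in> hom2 K f f"
    and vcomp_in: "\<lbrakk>\<phi> \<in> hom2 K f g; \<psi> \<in> hom2 K g h\<rbrakk> \<Longrightarrow> \<psi> \<cdot> \<phi> \<in> hom2 K f h"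
    and vcomp_Id2: "\<phi> \<in> hom2 K f g \<Longrightarrow> \<phi> \<cdot> Id2 K f = \<phi>"
    and Id2_vcomp: "\<phi> \<in> hom2 K f g \<Longrightarrow> Id2 K g \<cdot> \<phi> = \<phi>"
    and vcomp_assoc:
      "\<lbrakk>\<phi> \<in> hom2 K f g; \<psi> \<in> hom2 K g h; \<chi> \<in> hom2 K h k\<rbrakk> \<Longrightarrow> (\<chi> \<cdot> \<psi>) \<cdot> \<phi> = \<chi> \<cdot> (\<psi> \<cdot> \<phi>)"
    and hcomp_in:
      "\<lbrakk>\<phi> \<in> hom2 K f f'; \<psi> \<in> hom2 K g g'; Dom K g = Cod K f\<rbrakk>
        \<Longrightarrow> \<psi> \<star> \<phi> \<in> hom2 K (g \<odot> f) (g' \<odot> f')"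
    and hcomp_Id2_Id1: "\<lbrakk>\<phi> \<in> hom2 K f f'; f \<in> hom1 K X Y\<rbrakk> \<Longrightarrow> \<phi> \<star> Id2 K (Id1 K X) = \<phi>"
    and Id2_Id1_hcomp: "\<lbrakk>\<phi> \<in> hom2 K f f'; f \<in> hom1 K X Y\<rbrakk> \<Longrightarrow> Id2 K (Id1 K Y) \<star> \<phi> = \<phi>"
    and hcomp_assoc:
      "\<lbrakk>\<phi> \<in> hom2 K f f'; \<psi> \<in> hom2 K g g'; \<chi> \<in> hom2 K h h'; Dom K g = Cod K f; Dom K h = Cod K g\<rbrakk>
        \<Longrightarrow> (\<chi> \<star> \<psi>) \<star> \<phi> = \<chi> \<star> (\<psi> \<star> \<phi>)"
    and hcomp_Id2: "\<lbrakk>f \<in> hom1 K X Y; g \<in> hom1 K Y Z\<rbrakk> \<Longrightarrow> Id2 K g \<star> Id2 K f = Id2 K (g \<odot> f)"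
    and interchange:
      "\<lbrakk>\<phi> \<in> hom2 K f f'; \<phi>' \<in> hom2 K f' f''; \<psi> \<in> hom2 K g g'; \<psi>' \<in> hom2 K g' g'';
        Dom K g = Cod K f\<rbrakk>
        \<Longrightarrow> (\<psi>' \<cdot> \<psi>) \<star> (\<phi>' \<cdot> \<phi>) = (\<psi>' \<star> \<phi>') \<cdot> (\<psi> \<star> \<phi>)"

text \<open>
  A wide, locally full sub-2-category amounts to a set of 1-cells that contains the identities and
  is closed under composition.
\<close>

definition wide_locally_full :: "('o, 'm, 'c, 'x) two_cat_scheme \<Rightarrow> 'm set \<Rightarrow> bool" where
  "wide_locally_full K S \<longleftrightarrow> S \<subseteq> Mor K \<and> (\<forall>X \<in> Ob K. Id1 K X \<in> S) \<and>
     (\<forall>f \<in> S. \<forall>g \<in> S. Dom K g = Cod K f \<longrightarrow> g \<odot>\<^bsub>K\<^esub> f \<in> S)"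

locale enhanced_two_category = two_category K
  for K :: "('o, 'm, 'c, 'x) enhanced_two_cat_scheme" (structure) +
  assumes tight: "wide_locally_full K (Tight K)"

locale marked_two_category = enhanced_two_category K
  for K :: "('o, 'm, 'c, 'x) marked_two_cat_scheme" (structure) +
  assumes marked: "wide_locally_full K (Marked K)"

locale codotted_two_category = marked_two_category K
  for K :: "('o, 'm, 'c, 'x) codotted_two_cat_scheme" (structure) +
  assumes codotted_Ob: "Codotted K \<subseteq> Ob K"
    and codotted_closed:
      "\<lbrakk>t \<in> hom1 K A B; t \<in> Tight K; t \<in> Marked K; B \<in> Codotted K\<rbrakk> \<Longrightarrow> A \<in> Codotted K"

definition tight_iso ::
  "('o, 'm, 'c, 'x) enhanced_two_cat_scheme \<Rightarrow> 'o \<Rightarrow> 'o \<Rightarrow> 'm \<Rightarrow> bool" where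
  "tight_iso K X Y f \<longleftrightarrow> f \<in> hom1 K X Y \<and> f \<in> Tight K \<and>
     (\<exists>g \<in> hom1 K Y X. g \<in> Tight K \<and> g \<odot>\<^bsub>K\<^esub> f = Id1 K X \<and> f \<odot>\<^bsub>K\<^esub> g = Id1 K Y)"


section \<open>Lax terminal objects\<close>

text \<open>Here \<open>d X\<close> is the chosen 1-cell \<open>X \<leadsto> U\<close> and \<open>\<delta> f\<close> is the 2-cell called \<open>df\<close>.\<close>

definition marked_lax_terminal_data ::
  "('o, 'm, 'c, 'x) marked_two_cat_scheme \<Rightarrow> 'o \<Rightarrow> ('o \<Rightarrow> 'm) \<Rightarrow> ('m \<Rightarrow> 'c) \<Rightarrow> bool" where
  "marked_lax_terminal_data K U d \<delta> \<longleftrightarrow> U \<in> Ob K \<and>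
     (\<forall>X \<in> Ob K. d X \<in> hom1 K X U \<and> d X \<in> Marked K) \<and>
     (\<forall>f \<in> Mor K. hom2 K (d (Dom K f)) (d (Cod K f) \<odot>\<^bsub>K\<^esub> f) = {\<delta> f}) \<and>
     (\<forall>f \<in> Marked K. invertible2 K (\<delta> f)) \<and>
     (\<exists>\<iota> \<in> hom2 K (d U) (Id1 K U). invertible2 K \<iota>)"

definition codotted_lax_terminal :: "('o, 'm, 'c, 'x) codotted_two_cat_scheme \<Rightarrow> 'o \<Rightarrow> bool" where
  "codotted_lax_terminal K U \<longleftrightarrow> U \<in> Codotted K \<and>
     (\<exists>d \<delta>. marked_lax_terminal_data K U d \<delta> \<and> (\<forall>X \<in> Codotted K. d X \<in> Tight K))"


section \<open>Marked enhanced 2-monads\<close>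

record ('o, 'm, 'c) two_monad =
  T0 :: "'o \<Rightarrow> 'o"
  T1 :: "'m \<Rightarrow> 'm"
  T2 :: "'c \<Rightarrow> 'c"
  unit :: "'o \<Rightarrow> 'm"
  mult :: "'o \<Rightarrow> 'm"

locale marked_enhanced_two_monad = marked_two_category K
  for K :: "('o, 'm, 'c, 'x) marked_two_cat_scheme" (structure)
    and T :: "('o, 'm, 'c) two_monad" +
  assumes T0_in: "X \<in> Ob K \<Longrightarrow> T0 T X \<in> Ob K"
    and T1_in: "f \<in> hom1 K X Y \<Longrightarrow> T1 T f \<in> hom1 K (T0 T X) (T0 T Y)"
    and T2_in: "\<phi> \<in> hom2 K f g \<Longrightarrow> T2 T \<phi> \<in> hom2 K (T1 T f) (T1 T g)"
    and T1_Id1: "X \<in> Ob K \<Longrightarrow> T1 T (Id1 K X) = Id1 K (T0 T X)"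
    and T1_comp1: "\<lbrakk>f \<in> hom1 K X Y; g \<in> hom1 K Y Z\<rbrakk> \<Longrightarrow> T1 T (g \<odot> f) = T1 T g \<odot> T1 T f"
    and T2_Id2: "f \<in> Mor K \<Longrightarrow> T2 T (Id2 K f) = Id2 K (T1 T f)"
    and T2_vcomp:
      "\<lbrakk>\<phi> \<in> hom2 K f g; \<psi> \<in> hom2 K g h\<rbrakk> \<Longrightarrow> T2 T (\<psi> \<cdot> \<phi>) = T2 T \<psi> \<cdot> T2 T \<phi>"
    and T2_hcomp:
      "\<lbrakk>\<phi> \<in> hom2 K f f'; \<psi> \<in> hom2 K g g'; Dom K g = Cod K f\<rbrakk>
        \<Longrightarrow> T2 T (\<psi> \<star> \<phi>) = T2 T \<psi> \<star> T2 T \<phi>"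
    and unit_in: "X \<in> Ob K \<Longrightarrow> unit T X \<in> hom1 K X (T0 T X)"
    and unit_natural1:
      "f \<in> hom1 K X Y \<Longrightarrow> T1 T f \<odot> unit T X = unit T Y \<odot> f"
    and unit_natural2:
      "\<lbrakk>\<phi> \<in> hom2 K f g; f \<in> hom1 K X Y\<rbrakk> \<Longrightarrow> T2 T \<phi> \<lhd> unit T X = unit T Y \<rhd> \<phi>"
    and mult_in: "X \<in> Ob K \<Longrightarrow> mult T X \<in> hom1 K (T0 T (T0 T X)) (T0 T X)"
    and mult_natural1:
      "f \<in> hom1 K X Y \<Longrightarrow> T1 T f \<odot> mult T X = mult T Y \<odot> T1 T (T1 T f)"
    and mult_natural2:
      "\<lbrakk>\<phi> \<in> hom2 K f g; f \<in> hom1 K X Y\<rbrakk> \<Longrightarrow> T2 T \<phi> \<lhd> mult T X = mult T Y \<rhd> T2 T (T2 T \<phi>)"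
    and mult_unit: "X \<in> Ob K \<Longrightarrow> mult T X \<odot> unit T (T0 T X) = Id1 K (T0 T X)"
    and mult_T_unit: "X \<in> Ob K \<Longrightarrow> mult T X \<odot> T1 T (unit T X) = Id1 K (T0 T X)"
    and mult_assoc: "X \<in> Ob K \<Longrightarrow> mult T X \<odot> mult T (T0 T X) = mult T X \<odot> T1 T (mult T X)"
    and T1_tight: "f \<in> Tight K \<Longrightarrow> T1 T f \<in> Tight K"
    and unit_tight: "X \<in> Ob K \<Longrightarrow> unit T X \<in> Tight K"
    and mult_tight: "X \<in> Ob K \<Longrightarrow> mult T X \<in> Tight K"
    and T1_marked: "f \<in> Marked K \<Longrightarrow> T1 T f \<in> Marked K"


section \<open>The enhanced 2-category of lax algebras\<close>

datatype ('o, 'm, 'c) lax_alg =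
  LaxAlgebra (carrier: 'o) (struct: 'm) (lunit: 'c) (lmult: 'c)

datatype ('o, 'm, 'c) lax_mor =
  LaxMor (mdom: "('o, 'm, 'c) lax_alg") (mcod: "('o, 'm, 'c) lax_alg") (und: 'm) (bar: 'c)

datatype ('o, 'm, 'c) lax_cell =
  LaxCell (csrc: "('o, 'm, 'c) lax_mor") (ctgt: "('o, 'm, 'c) lax_mor") (ucell: 'c)

context
  fixes K :: "('o, 'm, 'c, 'x) codotted_two_cat_scheme" (structure)
    and T :: "('o, 'm, 'c) two_monad"
begin

fun lax_algebra :: "('o, 'm, 'c) lax_alg \<Rightarrow> bool" where
  "lax_algebra (LaxAlgebra A \<alpha> \<upsilon> \<mu>) \<longleftrightarrow>
     A \<in> Ob K \<and>
     \<alpha> \<in> hom1 K (T0 T A) A \<and> \<alpha> \<in> Tight K \<and>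
     \<upsilon> \<in> hom2 K (Id1 K A) (\<alpha> \<odot> unit T A) \<and>
     \<mu> \<in> hom2 K (\<alpha> \<odot> T1 T \<alpha>) (\<alpha> \<odot> mult T A) \<and>
     (\<mu> \<lhd> unit T (T0 T A)) \<cdot> (\<upsilon> \<lhd> \<alpha>) = Id2 K \<alpha> \<and>
     (\<mu> \<lhd> T1 T (unit T A)) \<cdot> (\<alpha> \<rhd> T2 T \<upsilon>) = Id2 K \<alpha> \<and>
     (\<mu> \<lhd> mult T (T0 T A)) \<cdot> (\<mu> \<lhd> T1 T (T1 T \<alpha>)) = (\<mu> \<lhd> T1 T (mult T A)) \<cdot> (\<alpha> \<rhd> T2 T \<mu>)"

fun lax_morphism :: "('o, 'm, 'c) lax_mor \<Rightarrow> bool" where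
  "lax_morphism (LaxMor (LaxAlgebra A \<alpha> \<upsilon>\<^sub>A \<mu>\<^sub>A) (LaxAlgebra B \<beta> \<upsilon>\<^sub>B \<mu>\<^sub>B) f f') \<longleftrightarrow>
     lax_algebra (LaxAlgebra A \<alpha> \<upsilon>\<^sub>A \<mu>\<^sub>A) \<and> lax_algebra (LaxAlgebra B \<beta> \<upsilon>\<^sub>B \<mu>\<^sub>B) \<and>
     f \<in> hom1 K A B \<and>
     f' \<in> hom2 K (\<beta> \<odot> T1 T f) (f \<odot> \<alpha>) \<and>
     f \<rhd> \<upsilon>\<^sub>A = (f' \<lhd> unit T A) \<cdot> (\<upsilon>\<^sub>B \<lhd> f) \<and>
     (f \<rhd> \<mu>\<^sub>A) \<cdot> (f' \<lhd> T1 T \<alpha>) \<cdot> (\<beta> \<rhd> T2 T f') = (f' \<lhd> mult T A) \<cdot> (\<mu>\<^sub>B \<lhd> T1 T (T1 T f))"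

fun lax_two_morphism :: "('o, 'm, 'c) lax_cell \<Rightarrow> bool" where
  "lax_two_morphism (LaxCell F G \<phi>) \<longleftrightarrow>
     lax_morphism F \<and> lax_morphism G \<and> mdom F = mdom G \<and> mcod F = mcod G \<and>
     \<phi> \<in> hom2 K (und F) (und G) \<and>
     (\<phi> \<lhd> struct (mdom F)) \<cdot> bar F = bar G \<cdot> (struct (mcod F) \<rhd> T2 T \<phi>)"

definition lax_mor_comp ::
  "('o, 'm, 'c) lax_mor \<Rightarrow> ('o, 'm, 'c) lax_mor \<Rightarrow> ('o, 'm, 'c) lax_mor" where
  "lax_mor_comp G F = LaxMor (mdom F) (mcod G) (und G \<odot> und F)
     ((und G \<rhd> bar F) \<cdot> (bar G \<lhd> T1 T (und F)))"

text \<open>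
  The class of codotted objects of \<open>LaxAlg\<close> need not satisfy the closure condition of
  \<open>codotted_two_category\<close>: a marked tight morphism into an algebra with marked structure map does
  not force the structure map of its domain to be marked.  The notion of codotted-lax terminal
  object only refers to the class itself.
\<close>

definition LaxAlg ::
  "(('o, 'm, 'c) lax_alg, ('o, 'm, 'c) lax_mor, ('o, 'm, 'c) lax_cell) codotted_two_cat" where
  "LaxAlg = \<lparr>
     Ob = {A. lax_algebra A},
     Mor = {F. lax_morphism F},
     Cell = {\<Phi>. lax_two_morphism \<Phi>},
     Dom = mdom,
     Cod = mcod,
     Id1 = (\<lambda>A. LaxMor A A (Id1 K (carrier A)) (Id2 K (struct A))),
     comp1 = lax_mor_comp,
     Src = csrc,
     Tgt = ctgt,
     Id2 = (\<lambda>F. LaxCell F F (Id2 K (und F))),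
     vcomp = (\<lambda>\<Psi> \<Phi>. LaxCell (csrc \<Phi>) (ctgt \<Psi>) (ucell \<Psi> \<cdot> ucell \<Phi>)),
     hcomp = (\<lambda>\<Psi> \<Phi>. LaxCell (lax_mor_comp (csrc \<Psi>) (csrc \<Phi>)) (lax_mor_comp (ctgt \<Psi>) (ctgt \<Phi>))
                (ucell \<Psi> \<star> ucell \<Phi>)),
     Tight = {F. lax_morphism F \<and> und F \<in> Tight K \<and> invertible2 K (bar F)},
     Marked = {F. lax_morphism F \<and> und F \<in> Marked K},
     Codotted = {A. lax_algebra A \<and> carrier A \<in> Codotted K \<and> struct A \<in> Marked K}\<rparr>"

end

end

theory Submission
  imports Defs
begin

text \<open>
  The whole theorem rests on one reformulation of marked-lax terminality (\<open>marked_initial\<close>): if \<open>U\<close>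
  is marked-lax terminal, then every marked \<open>g : X \<leadsto> U\<close> is an initial object of the hom-category
  of 1-cells \<open>X \<leadsto> U\<close>.  Indeed \<open>dX\<close> is initial there, because any \<open>k : X \<leadsto> U\<close> is isomorphic to
  \<open>dU \<circ> k\<close> through \<open>dU \<cong> id\<close>, and for marked \<open>g\<close> the cell \<open>dg : dX \<Rightarrow> dU \<circ> g\<close> is invertible, so
  that \<open>g \<cong> dX\<close>.  Consequently two parallel 2-cells between 1-cells into \<open>U\<close> agree as soon as
  their source is marked, and a 2-cell between two marked 1-cells into \<open>U\<close> is invertible.

  Take a marked tight \<open>\<alpha> : TU \<rightarrow> U\<close>; \<open>d(TU)\<close> is one, since \<open>TU\<close> is codotted.  As \<open>T\<close> preserves
  marked 1-cells, \<open>id\<close>, \<open>\<alpha>\<close>, \<open>\<alpha> \<circ> T\<alpha>\<close> and \<open>\<alpha> \<circ> T\<alpha> \<circ> TT\<alpha>\<close> are all marked.  They are the sources of the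
  unit and multiplication cells and of both sides of every lax algebra law, so the cells exist and
  the laws hold (\<open>lax_algebra_on_U\<close>).  In the same way, for a lax algebra on
  \<open>U\<close> with marked structure map, a marked 1-cell into \<open>U\<close> out of the carrier of another lax algebra
  becomes a lax morphism in exactly one way, and the unique 2-cell from it to another
  lax morphism is automatically a \<open>T\<close>-2-morphism (\<open>lax_morphism_into_U\<close>, \<open>lax_mor_eqI\<close>,
  \<open>lax_two_morphism_into_U\<close>).  Hence every lax algebra on \<open>U\<close> with marked structure map is
  codotted-lax terminal (\<open>codotted_lax_terminal_LaxAlg\<close>).

  Conversely a codotted-lax terminal algebra on \<open>U\<close> is codotted, so its structure map is marked.  Two
  marked structure maps \<open>TU \<rightarrow> U\<close> are uniquely isomorphic, and the isomorphism makes the identity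
  of \<open>U\<close> into a tight isomorphism of lax algebras (\<open>tight_iso_of_algebras_on_U\<close>).

  The one ingredient that uniqueness of cells does not give is that lax morphisms compose: for
  \<open>A \<leadsto> B \<leadsto> U\<close> with an arbitrary first factor the composite need not be marked, so its
  coherence laws are obtained by pasting (\<open>lax_mor_comp_lax_morphism\<close>).
\<close>

section \<open>Calculating with cells of a 2-category\<close>

text \<open>
  The axioms of a 2-category mention intermediate objects that do not occur in the terms they rewrite.
  Phrased through domains and codomains instead, they become conditional rewrite rules, and the
  simplifier both checks that cells are composable and reassociates all composites to the right.
\<close>

context two_category
begin

lemma Id1_simps [simp]:
  assumes "X \<in> Ob K"
  shows "Id1 K X \<in> Mor K" "Dom K (Id1 K X) = X" "Cod K (Id1 K X) = X"
  using Id1_in[OF assms] by (simp_all add: hom1_def)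

lemma comp1_simps [simp]:
  assumes "f \<in> Mor K" "g \<in> Mor K" "Dom K g = Cod K f"
  shows "g \<odot> f \<in> Mor K" "Dom K (g \<odot> f) = Dom K f" "Cod K (g \<odot> f) = Cod K g"
  using comp1_in[of f "Dom K f" "Cod K f" g "Cod K g"] assms by (simp_all add: hom1_def)

lemma comp1_Id1_simps [simp]:
  assumes "f \<in> Mor K"
  shows "Dom K f = X \<Longrightarrow> f \<odot> Id1 K X = f" "Cod K f = Y \<Longrightarrow> Id1 K Y \<odot> f = f"
  using comp1_Id1[of f] Id1_comp1[of f] assms by (auto simp: hom1_def)

lemma comp1_assoc' [simp]:
  assumes "f \<in> Mor K" "g \<in> Mor K" "h \<in> Mor K" "Dom K g = Cod K f" "Dom K h = Cod K g"
  shows "(h \<odot> g) \<odot> f = h \<odot> (g \<odot> f)"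
  using comp1_assoc[of f "Dom K f" "Cod K f" g "Cod K g" h "Cod K h"] assms
  by (simp add: hom1_def)

lemma Ob_simps [simp]:
  assumes "f \<in> Mor K"
  shows "Dom K f \<in> Ob K" "Cod K f \<in> Ob K"
  using assms by (simp_all add: Dom_in Cod_in)

lemma cell_simps [simp]:
  assumes "\<phi> \<in> Cell K"
  shows "Src K \<phi> \<in> Mor K" "Tgt K \<phi> \<in> Mor K"
    "Dom K (Tgt K \<phi>) = Dom K (Src K \<phi>)" "Cod K (Tgt K \<phi>) = Cod K (Src K \<phi>)"
  using Src_in[OF assms] Tgt_in[OF assms] by (simp_all add: hom1_def)

lemma Id2_simps [simp]:
  assumes "f \<in> Mor K"
  shows "Id2 K f \<in> Cell K" "Src K (Id2 K f) = f" "Tgt K (Id2 K f) = f"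
  using Id2_in[OF assms] by (simp_all add: hom2_def)

lemma vcomp_simps [simp]:
  assumes "\<phi> \<in> Cell K" "\<psi> \<in> Cell K" "Src K \<psi> = Tgt K \<phi>"
  shows "\<psi> \<cdot> \<phi> \<in> Cell K" "Src K (\<psi> \<cdot> \<phi>) = Src K \<phi>" "Tgt K (\<psi> \<cdot> \<phi>) = Tgt K \<psi>"
  using vcomp_in[of \<phi> "Src K \<phi>" "Tgt K \<phi>" \<psi> "Tgt K \<psi>"] assms by (simp_all add: hom2_def)

lemma vcomp_Id2_simps [simp]:
  assumes "\<phi> \<in> Cell K"
  shows "Src K \<phi> = f \<Longrightarrow> \<phi> \<cdot> Id2 K f = \<phi>" "Tgt K \<phi> = g \<Longrightarrow> Id2 K g \<cdot> \<phi> = \<phi>"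
  using vcomp_Id2[of \<phi>] Id2_vcomp[of \<phi>] assms by (auto simp: hom2_def)

lemma vcomp_assoc' [simp]:
  assumes "\<phi> \<in> Cell K" "\<psi> \<in> Cell K" "\<chi> \<in> Cell K" "Src K \<psi> = Tgt K \<phi>" "Src K \<chi> = Tgt K \<psi>"
  shows "(\<chi> \<cdot> \<psi>) \<cdot> \<phi> = \<chi> \<cdot> (\<psi> \<cdot> \<phi>)"
  using vcomp_assoc[of \<phi> "Src K \<phi>" "Tgt K \<phi>" \<psi> "Tgt K \<psi>" \<chi> "Tgt K \<chi>"] assms
  by (simp add: hom2_def)

lemma hcomp_simps [simp]:
  assumes "\<phi> \<in> Cell K" "\<psi> \<in> Cell K" "Dom K (Src K \<psi>) = Cod K (Src K \<phi>)"
  shows "\<psi> \<star> \<phi> \<in> Cell K" "Src K (\<psi> \<star> \<phi>) = Src K \<psi> \<odot> Src K \<phi>"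
    "Tgt K (\<psi> \<star> \<phi>) = Tgt K \<psi> \<odot> Tgt K \<phi>"
  using hcomp_in[of \<phi> "Src K \<phi>" "Tgt K \<phi>" \<psi> "Src K \<psi>" "Tgt K \<psi>"] assms
  by (simp_all add: hom2_def)

lemma hcomp_Id2_comp:
  assumes "f \<in> Mor K" "g \<in> Mor K" "Dom K g = Cod K f"
  shows "Id2 K g \<star> Id2 K f = Id2 K (g \<odot> f)"
  using hcomp_Id2[of f "Dom K f" "Cod K f" g "Cod K g"] assms by (simp add: hom1_def)

lemma hcomp_assoc' [simp]:
  assumes "\<phi> \<in> Cell K" "\<psi> \<in> Cell K" "\<chi> \<in> Cell K"
    "Dom K (Src K \<psi>) = Cod K (Src K \<phi>)" "Dom K (Src K \<chi>) = Cod K (Src K \<psi>)"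
  shows "(\<chi> \<star> \<psi>) \<star> \<phi> = \<chi> \<star> (\<psi> \<star> \<phi>)"
  using hcomp_assoc[of \<phi> "Src K \<phi>" "Tgt K \<phi>" \<psi> "Src K \<psi>" "Tgt K \<psi>" \<chi> "Src K \<chi>" "Tgt K \<chi>"] assms
  by (simp add: hom2_def)

lemma interchange':
  assumes "\<phi> \<in> Cell K" "\<phi>' \<in> Cell K" "\<psi> \<in> Cell K" "\<psi>' \<in> Cell K"
    "Src K \<phi>' = Tgt K \<phi>" "Src K \<psi>' = Tgt K \<psi>" "Dom K (Src K \<psi>) = Cod K (Src K \<phi>)"
  shows "(\<psi>' \<star> \<phi>') \<cdot> (\<psi> \<star> \<phi>) = (\<psi>' \<cdot> \<psi>) \<star> (\<phi>' \<cdot> \<phi>)"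
  using interchange[of \<phi> "Src K \<phi>" "Tgt K \<phi>" \<phi>' "Tgt K \<phi>'" \<psi> "Src K \<psi>" "Tgt K \<psi>" \<psi>' "Tgt K \<psi>'"] assms
  by (simp add: hom2_def)

lemma lwhisker_vcomp:
  assumes "\<phi> \<in> Cell K" "\<psi> \<in> Cell K" "Src K \<psi> = Tgt K \<phi>" "f \<in> Mor K" "Dom K f = Cod K (Src K \<phi>)"
  shows "f \<rhd> (\<psi> \<cdot> \<phi>) = (f \<rhd> \<psi>) \<cdot> (f \<rhd> \<phi>)"
  using assms interchange'[of \<phi> \<psi> "Id2 K f" "Id2 K f"] by simp

lemma rwhisker_vcomp:
  assumes "\<phi> \<in> Cell K" "\<psi> \<in> Cell K" "Src K \<psi> = Tgt K \<phi>" "f \<in> Mor K" "Cod K f = Dom K (Src K \<phi>)"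
  shows "(\<psi> \<cdot> \<phi>) \<lhd> f = (\<psi> \<lhd> f) \<cdot> (\<phi> \<lhd> f)"
  using assms interchange'[of "Id2 K f" "Id2 K f" \<phi> \<psi>] by simp

lemma lwhisker_lwhisker:
  assumes "\<phi> \<in> Cell K" "g \<in> Mor K" "f \<in> Mor K" "Dom K g = Cod K (Src K \<phi>)" "Dom K f = Cod K g"
  shows "f \<rhd> g \<rhd> \<phi> = (f \<odot> g) \<rhd> \<phi>"
  using assms hcomp_assoc'[of \<phi> "Id2 K g" "Id2 K f"] by (simp add: hcomp_Id2_comp)

lemma rwhisker_rwhisker:
  assumes "\<phi> \<in> Cell K" "g \<in> Mor K" "f \<in> Mor K" "Cod K g = Dom K (Src K \<phi>)" "Cod K f = Dom K g"
  shows "(\<phi> \<lhd> g) \<lhd> f = \<phi> \<lhd> (g \<odot> f)"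
  using assms by (simp add: hcomp_Id2_comp)

lemma whisker_exchange:
  assumes "\<phi> \<in> Cell K" "\<psi> \<in> Cell K" "Dom K (Src K \<psi>) = Cod K (Src K \<phi>)"
  shows "(\<psi> \<lhd> Tgt K \<phi>) \<cdot> (Src K \<psi> \<rhd> \<phi>) = (Tgt K \<psi> \<rhd> \<phi>) \<cdot> (\<psi> \<lhd> Src K \<phi>)"
  using assms by (simp add: interchange')

end

section \<open>Marked 1-cells into a marked-lax terminal object\<close>

context marked_two_category
begin

lemma Marked_in_Mor [simp]: "f \<in> Marked K \<Longrightarrow> f \<in> Mor K"
  using marked by (auto simp: wide_locally_full_def)

lemma Marked_Id1 [simp]: "X \<in> Ob K \<Longrightarrow> Id1 K X \<in> Marked K"
  using marked by (auto simp: wide_locally_full_def)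

lemma Marked_comp1 [simp]:
  "\<lbrakk>f \<in> Marked K; g \<in> Marked K; Dom K g = Cod K f\<rbrakk> \<Longrightarrow> g \<odot> f \<in> Marked K"
  using marked by (auto simp: wide_locally_full_def)

lemma Tight_Id1 [simp]: "X \<in> Ob K \<Longrightarrow> Id1 K X \<in> Tight K"
  using tight by (auto simp: wide_locally_full_def)

text \<open>
  With \<open>e : dX \<cong> g\<close> obtained from \<open>dg\<close> and \<open>dU \<cong> id\<close>, composing with \<open>e\<close> and \<open>k \<cong> dU \<circ> k\<close> turns
  cells \<open>g \<Rightarrow> k\<close> into cells \<open>dX \<Rightarrow> dU \<circ> k\<close>, and \<open>dk\<close> is the only one of these.
\<close>

lemma marked_initial:
  assumes U: "marked_lax_terminal_data K U d \<delta>"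
    and g: "g \<in> Marked K" "Cod K g = U"
    and k: "k \<in> Mor K" "Dom K k = Dom K g" "Cod K k = U"
  shows "\<exists>!\<phi>. \<phi> \<in> hom2 K g k"
proof -
  let ?X = "Dom K g"
  have gM [simp]: "g \<in> Mor K" using g by simp
  have UOb: "U \<in> Ob K" and dX: "d ?X \<in> hom1 K ?X U" and dU: "d U \<in> hom1 K U U"
    and \<delta>: "\<And>f. f \<in> Mor K \<Longrightarrow> hom2 K (d (Dom K f)) (d (Cod K f) \<odot> f) = {\<delta> f}"
    and inv\<delta>: "invertible2 K (\<delta> g)"
    using U g by (auto simp: marked_lax_terminal_data_def)
  obtain \<iota> \<kappa> where \<iota>: "\<iota> \<in> hom2 K (d U) (Id1 K U)" and \<kappa>: "\<kappa> \<in> hom2 K (Id1 K U) (d U)"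
    and \<iota>\<kappa>: "\<iota> \<cdot> \<kappa> = Id2 K (Id1 K U)"
    using U unfolding marked_lax_terminal_data_def invertible2_def by (auto simp: hom2_def)
  have \<delta>g: "\<delta> g \<in> hom2 K (d ?X) (d U \<odot> g)" and \<delta>k: "\<delta> k \<in> hom2 K (d ?X) (d U \<odot> k)"
    using \<delta>[of g] \<delta>[of k] g k by auto
  obtain \<epsilon> where \<epsilon>: "\<epsilon> \<in> hom2 K (d U \<odot> g) (d ?X)" "\<delta> g \<cdot> \<epsilon> = Id2 K (d U \<odot> g)"
    using inv\<delta> \<delta>g unfolding invertible2_def by (auto simp: hom2_def)
  note ty = UOb dX dU \<iota> \<kappa> \<delta>g \<delta>k \<epsilon>(1) g k
  have wh: "\<iota> \<lhd> f \<in> hom2 K (d U \<odot> f) f" "\<kappa> \<lhd> f \<in> hom2 K f (d U \<odot> f)"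
      "(\<iota> \<lhd> f) \<cdot> (\<kappa> \<lhd> f) = Id2 K f"
    if "f \<in> Mor K" "Cod K f = U" for f
  proof -
    show "\<iota> \<lhd> f \<in> hom2 K (d U \<odot> f) f" "\<kappa> \<lhd> f \<in> hom2 K f (d U \<odot> f)"
      using that ty by (simp_all add: hom1_def hom2_def)
    show "(\<iota> \<lhd> f) \<cdot> (\<kappa> \<lhd> f) = Id2 K f"
      by (subst rwhisker_vcomp[symmetric])
         (use that ty \<iota>\<kappa> in \<open>simp_all add: hom1_def hom2_def hcomp_Id2_comp\<close>)
  qed
  define e where "e = (\<iota> \<lhd> g) \<cdot> \<delta> g"
  define e' where "e' = \<epsilon> \<cdot> (\<kappa> \<lhd> g)"
  note wg = wh[OF gM g(2)] and wk = wh[OF k(1,3)]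
  have e: "e \<in> hom2 K (d ?X) g"
    unfolding e_def by (rule vcomp_in[OF \<delta>g wg(1)])
  have e': "e' \<in> hom2 K g (d ?X)"
    unfolding e'_def by (rule vcomp_in[OF wg(2) \<epsilon>(1)])
  have ee': "e \<cdot> e' = Id2 K g"
  proof -
    have "e \<cdot> e' = (\<iota> \<lhd> g) \<cdot> (\<delta> g \<cdot> \<epsilon>) \<cdot> (\<kappa> \<lhd> g)"
      unfolding e_def e'_def using wg(1,2) \<delta>g \<epsilon>(1) by (simp add: hom2_def)
    also have "\<dots> = Id2 K g"
      unfolding \<epsilon>(2) using wg by (simp add: hom2_def)
    finally show ?thesis .
  qed
  show ?thesis
  proof (rule ex_ex1I)
    show "\<exists>\<phi>. \<phi> \<in> hom2 K g k"
      using vcomp_in[OF vcomp_in[OF e' \<delta>k] wk(1)] by blast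
  next
    fix \<phi> \<phi>' assume \<phi>: "\<phi> \<in> hom2 K g k" and \<phi>': "\<phi>' \<in> hom2 K g k"
    \<comment> \<open>Transporting \<open>\<chi>\<close> to a cell \<open>dX \<Rightarrow> dU \<circ> k\<close> gives \<open>dk\<close>; transporting back recovers \<open>\<chi>\<close>.\<close>
    have fac: "\<chi> = (\<iota> \<lhd> k) \<cdot> \<delta> k \<cdot> e'" if \<chi>: "\<chi> \<in> hom2 K g k" for \<chi>
    proof -
      have "(\<kappa> \<lhd> k) \<cdot> \<chi> \<cdot> e \<in> hom2 K (d ?X) (d U \<odot> k)"
        by (rule vcomp_in[OF vcomp_in[OF e \<chi>] wk(2)])
      then have "(\<kappa> \<lhd> k) \<cdot> \<chi> \<cdot> e = \<delta> k" using \<delta>[of k] k by auto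
      then have "(\<iota> \<lhd> k) \<cdot> \<delta> k \<cdot> e' = (\<iota> \<lhd> k) \<cdot> ((\<kappa> \<lhd> k) \<cdot> \<chi> \<cdot> e) \<cdot> e'" by simp
      also have "\<dots> = ((\<iota> \<lhd> k) \<cdot> (\<kappa> \<lhd> k)) \<cdot> \<chi> \<cdot> (e \<cdot> e')"
        using wk(1,2) \<chi> e e' by (simp add: hom2_def)
      also have "\<dots> = \<chi>" unfolding wk(3) ee' using \<chi> k by (simp add: hom2_def)
      finally show ?thesis by simp
    qed
    show "\<phi> = \<phi>'" using fac[OF \<phi>] fac[OF \<phi>'] by simp
  qed
qed

lemma marked_cells_eq:
  assumes U: "marked_lax_terminal_data K U d \<delta>"
    and "\<phi> \<in> hom2 K g k" "\<psi> \<in> hom2 K g k" "g \<in> Marked K" "Cod K g = U"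
  shows "\<phi> = \<psi>"
proof -
  have "k \<in> Mor K" "Dom K k = Dom K g" "Cod K k = U"
    using cell_simps[of \<phi>] assms by (auto simp: hom2_def)
  then show ?thesis using marked_initial[OF U] assms by blast
qed

text \<open>Two initial objects are isomorphic, by any cell between them.\<close>

lemma marked_cells_invertible:
  assumes U: "marked_lax_terminal_data K U d \<delta>"
    and \<phi>: "\<phi> \<in> hom2 K g k" and g: "g \<in> Marked K" "k \<in> Marked K" "Cod K g = U"
  shows "invertible2 K \<phi>"
proof -
  have k: "Dom K k = Dom K g" "Cod K k = U"
    using cell_simps[of \<phi>] \<phi> g by (auto simp: hom2_def)
  obtain \<psi> where \<psi>: "\<psi> \<in> hom2 K k g"
    using marked_initial[OF U, of k g] g k by auto
  have "\<psi> \<cdot> \<phi> = Id2 K g"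
    by (rule marked_cells_eq[OF U vcomp_in[OF \<phi> \<psi>] Id2_in]) (simp_all add: g)
  moreover have "\<phi> \<cdot> \<psi> = Id2 K k"
    by (rule marked_cells_eq[OF U vcomp_in[OF \<psi> \<phi>] Id2_in]) (simp_all add: g k)
  ultimately show ?thesis using \<phi> \<psi> by (auto simp: invertible2_def hom2_def)
qed

end

section \<open>Composing lax morphisms\<close>

context marked_enhanced_two_monad
begin

lemma T1_simps [simp]:
  assumes "f \<in> Mor K"
  shows "T1 T f \<in> Mor K" "Dom K (T1 T f) = T0 T (Dom K f)" "Cod K (T1 T f) = T0 T (Cod K f)"
  using T1_in[of f "Dom K f" "Cod K f"] assms by (simp_all add: hom1_def)

lemma T2_simps [simp]:
  assumes "\<phi> \<in> Cell K"
  shows "T2 T \<phi> \<in> Cell K" "Src K (T2 T \<phi>) = T1 T (Src K \<phi>)" "Tgt K (T2 T \<phi>) = T1 T (Tgt K \<phi>)"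
  using T2_in[of \<phi> "Src K \<phi>" "Tgt K \<phi>"] assms by (simp_all add: hom2_def)

lemma unit_simps [simp]:
  assumes "X \<in> Ob K"
  shows "unit T X \<in> Mor K" "Dom K (unit T X) = X" "Cod K (unit T X) = T0 T X"
  using unit_in[OF assms] by (simp_all add: hom1_def)

lemma mult_simps [simp]:
  assumes "X \<in> Ob K"
  shows "mult T X \<in> Mor K" "Dom K (mult T X) = T0 T (T0 T X)" "Cod K (mult T X) = T0 T X"
  using mult_in[OF assms] by (simp_all add: hom1_def)

lemma T1_comp1' [simp]:
  "\<lbrakk>f \<in> Mor K; g \<in> Mor K; Dom K g = Cod K f\<rbrakk> \<Longrightarrow> T1 T (g \<odot> f) = T1 T g \<odot> T1 T f"
  using T1_comp1[of f "Dom K f" "Cod K f" g "Cod K g"] by (simp add: hom1_def)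

text \<open>
  The unit and the multiplication are moved to the left past images of \<open>T\<close>, and iterated
  multiplications are written without \<open>T\<close>.  Because composites are kept nested to the right, each
  such rule comes with a second form in which further 1-cells follow.
\<close>

lemma unit_natural [simp]:
  assumes "f \<in> Mor K" "Dom K f = X"
  shows "T1 T f \<odot> unit T X = unit T (Cod K f) \<odot> f"
    "\<lbrakk>k \<in> Mor K; Cod K k = X\<rbrakk> \<Longrightarrow> T1 T f \<odot> unit T X \<odot> k = unit T (Cod K f) \<odot> f \<odot> k"
proof -
  show *: "T1 T f \<odot> unit T X = unit T (Cod K f) \<odot> f"
    using unit_natural1[of f X "Cod K f"] assms by (simp add: hom1_def)
  show "T1 T f \<odot> unit T X \<odot> k = unit T (Cod K f) \<odot> f \<odot> k" if "k \<in> Mor K" "Cod K k = X"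
  proof -
    have X: "X \<in> Ob K" using assms by auto
    have "T1 T f \<odot> unit T X \<odot> k = (T1 T f \<odot> unit T X) \<odot> k"
      by (rule comp1_assoc'[symmetric]) (simp_all add: X assms that)
    also have "\<dots> = unit T (Cod K f) \<odot> f \<odot> k"
      unfolding * by (simp add: X assms that)
    finally show ?thesis .
  qed
qed

lemma mult_natural [simp]:
  assumes "f \<in> Mor K" "Dom K f = X"
  shows "T1 T f \<odot> mult T X = mult T (Cod K f) \<odot> T1 T (T1 T f)"
    "\<lbrakk>k \<in> Mor K; Cod K k = T0 T (T0 T X)\<rbrakk>
      \<Longrightarrow> T1 T f \<odot> mult T X \<odot> k = mult T (Cod K f) \<odot> T1 T (T1 T f) \<odot> k"
proof -
  show *: "T1 T f \<odot> mult T X = mult T (Cod K f) \<odot> T1 T (T1 T f)"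
    using mult_natural1[of f X "Cod K f"] assms by (simp add: hom1_def)
  show "T1 T f \<odot> mult T X \<odot> k = mult T (Cod K f) \<odot> T1 T (T1 T f) \<odot> k"
    if "k \<in> Mor K" "Cod K k = T0 T (T0 T X)"
  proof -
    have X: "X \<in> Ob K" using assms by auto
    have "T1 T f \<odot> mult T X \<odot> k = (T1 T f \<odot> mult T X) \<odot> k"
      by (rule comp1_assoc'[symmetric]) (simp_all add: X assms that)
    also have "\<dots> = mult T (Cod K f) \<odot> T1 T (T1 T f) \<odot> k"
      unfolding * by (simp add: X assms that)
    finally show ?thesis .
  qed
qed

lemma monad_simps [simp]:
  assumes "X \<in> Ob K"
  shows "T0 T X \<in> Ob K" "T1 T (Id1 K X) = Id1 K (T0 T X)"
    "mult T X \<odot> unit T (T0 T X) = Id1 K (T0 T X)"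
    "mult T X \<odot> T1 T (unit T X) = Id1 K (T0 T X)"
    "mult T X \<odot> T1 T (mult T X) = mult T X \<odot> mult T (T0 T X)"
  using assms by (simp_all add: T0_in T1_Id1 mult_unit mult_T_unit flip: mult_assoc)

declare T1_marked [simp] T2_Id2 [simp]

lemma mult_unit_comp1 [simp]:
  assumes "X \<in> Ob K" "k \<in> Mor K" "Cod K k = T0 T X"
  shows "mult T X \<odot> unit T (T0 T X) \<odot> k = k"
proof -
  have "mult T X \<odot> unit T (T0 T X) \<odot> k = (mult T X \<odot> unit T (T0 T X)) \<odot> k"
    by (rule comp1_assoc'[symmetric]) (simp_all add: assms)
  then show ?thesis using assms by simp
qed

lemma T2_vcomp':
  "\<lbrakk>\<phi> \<in> Cell K; \<psi> \<in> Cell K; Src K \<psi> = Tgt K \<phi>\<rbrakk> \<Longrightarrow> T2 T (\<psi> \<cdot> \<phi>) = T2 T \<psi> \<cdot> T2 T \<phi>"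
  using T2_vcomp[of \<phi> "Src K \<phi>" "Tgt K \<phi>" \<psi> "Tgt K \<psi>"] by (simp add: hom2_def)

lemma T2_hcomp':
  "\<lbrakk>\<phi> \<in> Cell K; \<psi> \<in> Cell K; Dom K (Src K \<psi>) = Cod K (Src K \<phi>)\<rbrakk>
    \<Longrightarrow> T2 T (\<psi> \<star> \<phi>) = T2 T \<psi> \<star> T2 T \<phi>"
  using T2_hcomp[of \<phi> "Src K \<phi>" "Tgt K \<phi>" \<psi> "Src K \<psi>" "Tgt K \<psi>"] by (simp add: hom2_def)

end

locale codotted_monad = codotted_two_category K + marked_enhanced_two_monad K T
  for K :: "('o, 'm, 'c, 'x) codotted_two_cat_scheme" (structure)
    and T :: "('o, 'm, 'c) two_monad"
begin


lemma lax_morphismD: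
  assumes "lax_morphism K T F"
  shows "lax_algebra K T (mdom F)" "lax_algebra K T (mcod F)"
    "und F \<in> hom1 K (carrier (mdom F)) (carrier (mcod F))"
    "bar F \<in> hom2 K (struct (mcod F) \<odot> T1 T (und F)) (und F \<odot> struct (mdom F))"
proof -
  obtain A B f f' where F: "F = LaxMor A B f f'" by (cases F)
  show "lax_algebra K T (mdom F)" "lax_algebra K T (mcod F)"
    "und F \<in> hom1 K (carrier (mdom F)) (carrier (mcod F))"
    "bar F \<in> hom2 K (struct (mcod F) \<odot> T1 T (und F)) (und F \<odot> struct (mdom F))"
    using assms unfolding F by (cases A; cases B; auto)+
qed

lemma lax_algebraD:
  assumes "lax_algebra K T A"
  shows "carrier A \<in> Ob K" "struct A \<in> hom1 K (T0 T (carrier A)) (carrier A)"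
  using assms by (cases A; auto)+

lemma hom2_LaxAlg_iff:
  "\<Phi> \<in> hom2 (LaxAlg K T) F G \<longleftrightarrow> lax_two_morphism K T \<Phi> \<and> csrc \<Phi> = F \<and> ctgt \<Phi> = G"
  by (auto simp: hom2_def LaxAlg_def)

text \<open>
  The unit triangle of the composite is the triangle of \<open>f\<close> whiskered by \<open>g\<close> pasted to the triangle
  of \<open>g\<close> whiskered by \<open>f\<close>; naturality of the unit identifies the two boundaries where they meet.
\<close>

lemma comp_lunit_coherence:
  assumes "A \<in> Ob K" "\<alpha> \<in> hom1 K (T0 T A) A" "\<upsilon>\<^sub>A \<in> hom2 K (Id1 K A) (\<alpha> \<odot> unit T A)"
    and "B \<in> Ob K" "\<beta> \<in> hom1 K (T0 T B) B" "\<upsilon>\<^sub>B \<in> hom2 K (Id1 K B) (\<beta> \<odot> unit T B)"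
    and "C \<in> Ob K" "\<gamma> \<in> hom1 K (T0 T C) C" "\<upsilon>\<^sub>C \<in> hom2 K (Id1 K C) (\<gamma> \<odot> unit T C)"
    and "f \<in> hom1 K A B" "f' \<in> hom2 K (\<beta> \<odot> T1 T f) (f \<odot> \<alpha>)"
    and "g \<in> hom1 K B C" "g' \<in> hom2 K (\<gamma> \<odot> T1 T g) (g \<odot> \<beta>)"
    and f_unit: "f \<rhd> \<upsilon>\<^sub>A = (f' \<lhd> unit T A) \<cdot> (\<upsilon>\<^sub>B \<lhd> f)"
    and g_unit: "g \<rhd> \<upsilon>\<^sub>B = (g' \<lhd> unit T B) \<cdot> (\<upsilon>\<^sub>C \<lhd> g)"
  shows "(g \<odot> f) \<rhd> \<upsilon>\<^sub>A
    = (((g \<rhd> f') \<cdot> (g' \<lhd> T1 T f)) \<lhd> unit T A) \<cdot> (\<upsilon>\<^sub>C \<lhd> (g \<odot> f))"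
proof -
  note ty = assms(1-13)[unfolded hom1_def hom2_def, simplified]
  have "(g \<odot> f) \<rhd> \<upsilon>\<^sub>A = g \<rhd> (f \<rhd> \<upsilon>\<^sub>A)"
    by (rule lwhisker_lwhisker[symmetric]) (simp_all add: ty)
  also have "\<dots> = (g \<rhd> (f' \<lhd> unit T A)) \<cdot> (g \<rhd> (\<upsilon>\<^sub>B \<lhd> f))"
    unfolding f_unit by (subst lwhisker_vcomp) (simp_all add: ty)
  also have "g \<rhd> (\<upsilon>\<^sub>B \<lhd> f) = (g' \<lhd> (unit T B \<odot> f)) \<cdot> (\<upsilon>\<^sub>C \<lhd> (g \<odot> f))"
    using arg_cong[OF g_unit, of "\<lambda>\<phi>. \<phi> \<lhd> f"] by (simp add: ty rwhisker_vcomp hcomp_Id2_comp)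
  also have "(g \<rhd> (f' \<lhd> unit T A)) \<cdot> (g' \<lhd> (unit T B \<odot> f)) \<cdot> (\<upsilon>\<^sub>C \<lhd> (g \<odot> f))
      = ((g \<rhd> (f' \<lhd> unit T A)) \<cdot> (g' \<lhd> (unit T B \<odot> f))) \<cdot> (\<upsilon>\<^sub>C \<lhd> (g \<odot> f))"
    by (rule vcomp_assoc'[symmetric]) (simp_all add: ty)
  also have "(g \<rhd> (f' \<lhd> unit T A)) \<cdot> (g' \<lhd> (unit T B \<odot> f))
      = ((g \<rhd> f') \<cdot> (g' \<lhd> T1 T f)) \<lhd> unit T A"
    by (subst rwhisker_vcomp) (simp_all add: ty hcomp_Id2_comp)
  finally show ?thesis .
qed

text \<open>
  The multiplication hexagon of the composite is the hexagon of \<open>f\<close> whiskered by \<open>g\<close> pasted to the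
  hexagon of \<open>g\<close> whiskered by \<open>TTf\<close>.  The cells \<open>g'\<close> and \<open>T f'\<close> stand in the wrong order for this
  and are exchanged first.
\<close>

lemma comp_lmult_coherence:
  assumes "A \<in> Ob K" "\<alpha> \<in> hom1 K (T0 T A) A" "\<mu>\<^sub>A \<in> hom2 K (\<alpha> \<odot> T1 T \<alpha>) (\<alpha> \<odot> mult T A)"
    and "B \<in> Ob K" "\<beta> \<in> hom1 K (T0 T B) B" "\<mu>\<^sub>B \<in> hom2 K (\<beta> \<odot> T1 T \<beta>) (\<beta> \<odot> mult T B)"
    and "C \<in> Ob K" "\<gamma> \<in> hom1 K (T0 T C) C" "\<mu>\<^sub>C \<in> hom2 K (\<gamma> \<odot> T1 T \<gamma>) (\<gamma> \<odot> mult T C)"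
    and "f \<in> hom1 K A B" "f' \<in> hom2 K (\<beta> \<odot> T1 T f) (f \<odot> \<alpha>)"
    and "g \<in> hom1 K B C" "g' \<in> hom2 K (\<gamma> \<odot> T1 T g) (g \<odot> \<beta>)"
    and f_mult: "(f \<rhd> \<mu>\<^sub>A) \<cdot> (f' \<lhd> T1 T \<alpha>) \<cdot> (\<beta> \<rhd> T2 T f')
      = (f' \<lhd> mult T A) \<cdot> (\<mu>\<^sub>B \<lhd> T1 T (T1 T f))"
    and g_mult: "(g \<rhd> \<mu>\<^sub>B) \<cdot> (g' \<lhd> T1 T \<beta>) \<cdot> (\<gamma> \<rhd> T2 T g')
      = (g' \<lhd> mult T B) \<cdot> (\<mu>\<^sub>C \<lhd> T1 T (T1 T g))"
  defines "c \<equiv> (g \<rhd> f') \<cdot> (g' \<lhd> T1 T f)"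
  shows "((g \<odot> f) \<rhd> \<mu>\<^sub>A) \<cdot> (c \<lhd> T1 T \<alpha>) \<cdot> (\<gamma> \<rhd> T2 T c)
      = (c \<lhd> mult T A) \<cdot> (\<mu>\<^sub>C \<lhd> T1 T (T1 T (g \<odot> f)))"
proof -
  note ty = assms(1-13)[unfolded hom1_def hom2_def, simplified]
  let ?TTf = "T1 T (T1 T f)"
  \<comment> \<open>The hexagon of \<open>f\<close> becomes \<open>a b y1 = p q\<close>, that of \<open>g\<close> becomes \<open>q y2 z = r s\<close>, and the exchange
      law reads \<open>x1 x2 = y1 y2\<close>; the goal is \<open>a (b x1) (x2 z) = (p r) s\<close>.\<close>
  let ?a = "g \<rhd> (f \<rhd> \<mu>\<^sub>A)" and ?b = "g \<rhd> (f' \<lhd> T1 T \<alpha>)" and ?y1 = "g \<rhd> (\<beta> \<rhd> T2 T f')"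
  let ?x1 = "g' \<lhd> (T1 T f \<odot> T1 T \<alpha>)" and ?x2 = "(\<gamma> \<odot> T1 T g) \<rhd> T2 T f'"
  let ?y2 = "g' \<lhd> (T1 T \<beta> \<odot> ?TTf)" and ?z = "(\<gamma> \<rhd> T2 T g') \<lhd> ?TTf"
  let ?p = "g \<rhd> (f' \<lhd> mult T A)" and ?q = "g \<rhd> (\<mu>\<^sub>B \<lhd> ?TTf)"
  let ?r = "g' \<lhd> (mult T B \<odot> ?TTf)" and ?s = "\<mu>\<^sub>C \<lhd> (T1 T (T1 T g) \<odot> ?TTf)"
  have c_struct: "c \<lhd> T1 T \<alpha> = ?b \<cdot> ?x1"
    unfolding c_def by (subst rwhisker_vcomp) (simp_all add: ty hcomp_Id2_comp)
  have struct_c: "\<gamma> \<rhd> T2 T c = ?x2 \<cdot> ?z"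
    unfolding c_def
    by (simp add: ty T2_vcomp' T2_hcomp' lwhisker_vcomp hcomp_Id2_comp flip: lwhisker_lwhisker)
  have c_mult: "c \<lhd> mult T A = ?p \<cdot> ?r"
    unfolding c_def by (subst rwhisker_vcomp) (simp_all add: ty hcomp_Id2_comp)
  have exch: "?x1 \<cdot> ?x2 = ?y1 \<cdot> ?y2"
    using whisker_exchange[of "T2 T f'" g'] by (simp add: ty flip: lwhisker_lwhisker)
  have f_hex: "?a \<cdot> ?b \<cdot> ?y1 = ?p \<cdot> ?q"
    using arg_cong[OF f_mult, of "\<lambda>\<phi>. g \<rhd> \<phi>"] by (simp add: ty lwhisker_vcomp)
  have g_hex: "?q \<cdot> ?y2 \<cdot> ?z = ?r \<cdot> ?s"
    using arg_cong[OF g_mult, of "\<lambda>\<phi>. \<phi> \<lhd> ?TTf"] by (simp add: ty rwhisker_vcomp hcomp_Id2_comp)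
  have "((g \<odot> f) \<rhd> \<mu>\<^sub>A) \<cdot> (c \<lhd> T1 T \<alpha>) \<cdot> (\<gamma> \<rhd> T2 T c) = ?a \<cdot> (?b \<cdot> ?x1) \<cdot> (?x2 \<cdot> ?z)"
    unfolding c_struct struct_c by (simp add: ty flip: lwhisker_lwhisker)
  also have "\<dots> = ?a \<cdot> ?b \<cdot> (?x1 \<cdot> ?x2) \<cdot> ?z"
    by (simp add: ty)
  also have "\<dots> = (?a \<cdot> ?b \<cdot> ?y1) \<cdot> ?y2 \<cdot> ?z"
    unfolding exch by (simp add: ty)
  also have "\<dots> = ?p \<cdot> (?q \<cdot> ?y2 \<cdot> ?z)"
    unfolding f_hex by (simp add: ty)
  also have "\<dots> = (?p \<cdot> ?r) \<cdot> ?s"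
    unfolding g_hex by (simp add: ty)
  finally show ?thesis
    unfolding c_mult by (simp add: ty)
qed

lemma lax_mor_comp_lax_morphism:
  assumes "lax_morphism K T F" "lax_morphism K T G" "mdom G = mcod F"
  shows "lax_morphism K T (lax_mor_comp K T G F)"
proof -
  obtain A \<alpha> \<upsilon>\<^sub>A \<mu>\<^sub>A B \<beta> \<upsilon>\<^sub>B \<mu>\<^sub>B f f' where
    F: "F = LaxMor (LaxAlgebra A \<alpha> \<upsilon>\<^sub>A \<mu>\<^sub>A) (LaxAlgebra B \<beta> \<upsilon>\<^sub>B \<mu>\<^sub>B) f f'"
    by (metis lax_alg.exhaust lax_mor.exhaust)
  obtain C \<gamma> \<upsilon>\<^sub>C \<mu>\<^sub>C g g' where
    G: "G = LaxMor (LaxAlgebra B \<beta> \<upsilon>\<^sub>B \<mu>\<^sub>B) (LaxAlgebra C \<gamma> \<upsilon>\<^sub>C \<mu>\<^sub>C) g g'"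
    using assms(3) F by (metis lax_alg.exhaust lax_mor.exhaust lax_mor.sel(1,2))
  note F' = assms(1)[unfolded F lax_morphism.simps] and G' = assms(2)[unfolded G lax_morphism.simps]
  have cells: "A \<in> Ob K" "\<alpha> \<in> hom1 K (T0 T A) A"
      "\<upsilon>\<^sub>A \<in> hom2 K (Id1 K A) (\<alpha> \<odot> unit T A)" "\<mu>\<^sub>A \<in> hom2 K (\<alpha> \<odot> T1 T \<alpha>) (\<alpha> \<odot> mult T A)"
      "B \<in> Ob K" "\<beta> \<in> hom1 K (T0 T B) B"
      "\<upsilon>\<^sub>B \<in> hom2 K (Id1 K B) (\<beta> \<odot> unit T B)" "\<mu>\<^sub>B \<in> hom2 K (\<beta> \<odot> T1 T \<beta>) (\<beta> \<odot> mult T B)"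
      "C \<in> Ob K" "\<gamma> \<in> hom1 K (T0 T C) C"
      "\<upsilon>\<^sub>C \<in> hom2 K (Id1 K C) (\<gamma> \<odot> unit T C)" "\<mu>\<^sub>C \<in> hom2 K (\<gamma> \<odot> T1 T \<gamma>) (\<gamma> \<odot> mult T C)"
      "f \<in> hom1 K A B" "f' \<in> hom2 K (\<beta> \<odot> T1 T f) (f \<odot> \<alpha>)"
      "g \<in> hom1 K B C" "g' \<in> hom2 K (\<gamma> \<odot> T1 T g) (g \<odot> \<beta>)"
    using F' G' by auto
  have "(g \<rhd> f') \<cdot> (g' \<lhd> T1 T f) \<in> hom2 K (\<gamma> \<odot> T1 T (g \<odot> f)) ((g \<odot> f) \<odot> \<alpha>)"
    using cells by (simp add: hom1_def hom2_def)
  moreover have "g \<odot> f \<in> hom1 K A C"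
    using cells by (simp add: hom1_def)
  moreover note comp_lunit_coherence[of A \<alpha> \<upsilon>\<^sub>A B \<beta> \<upsilon>\<^sub>B C \<gamma> \<upsilon>\<^sub>C f f' g g']
    comp_lmult_coherence[of A \<alpha> \<mu>\<^sub>A B \<beta> \<mu>\<^sub>B C \<gamma> \<mu>\<^sub>C f f' g g']
  ultimately show ?thesis
    using F' G' cells unfolding F G by (simp add: lax_mor_comp_def del: lax_algebra.simps)
qed

end

section \<open>Lax algebras on the lax terminal object\<close>

locale lax_terminal_monad = codotted_monad K T
  for K :: "('o, 'm, 'c, 'x) codotted_two_cat_scheme" (structure)
    and T :: "('o, 'm, 'c) two_monad" +
  fixes U :: 'o and d :: "'o \<Rightarrow> 'm" and \<delta> :: "'m \<Rightarrow> 'c"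
  assumes terminal: "marked_lax_terminal_data K U d \<delta>"
begin

lemma U_Ob [simp]: "U \<in> Ob K"
  using terminal by (simp add: marked_lax_terminal_data_def)

text \<open>
  Both unit laws compare endomorphisms of the marked 1-cell \<open>\<alpha>\<close>, and the associativity law compares
  cells out of the marked 1-cell \<open>\<alpha> \<circ> T\<alpha> \<circ> TT\<alpha>\<close>.  The 1-cells \<open>\<alpha> \<circ> i\<close> and \<open>\<alpha> \<circ> m\<close>, possibly
  unmarked, occur only on the target side.
\<close>

lemma lax_algebra_on_U:
  assumes \<alpha>: "\<alpha> \<in> hom1 K (T0 T U) U" "\<alpha> \<in> Tight K" "\<alpha> \<in> Marked K"
  shows "\<exists>\<upsilon> \<mu>. lax_algebra K T (LaxAlgebra U \<alpha> \<upsilon> \<mu>)"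
proof -
  have ty [simp]: "\<alpha> \<in> Mor K" "Dom K \<alpha> = T0 T U" "Cod K \<alpha> = U"
    using \<alpha> by (auto simp: hom1_def)
  obtain \<upsilon> where \<upsilon>: "\<upsilon> \<in> hom2 K (Id1 K U) (\<alpha> \<odot> unit T U)"
    using marked_initial[OF terminal, of "Id1 K U" "\<alpha> \<odot> unit T U"] by auto
  obtain \<mu> where \<mu>: "\<mu> \<in> hom2 K (\<alpha> \<odot> T1 T \<alpha>) (\<alpha> \<odot> mult T U)"
    using marked_initial[OF terminal, of "\<alpha> \<odot> T1 T \<alpha>" "\<alpha> \<odot> mult T U"] \<alpha>(3) by auto
  note cells = \<upsilon>[unfolded hom2_def, simplified] \<mu>[unfolded hom2_def, simplified]
  have "(\<mu> \<lhd> unit T (T0 T U)) \<cdot> (\<upsilon> \<lhd> \<alpha>) = Id2 K \<alpha>"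
    by (rule marked_cells_eq[OF terminal, of _ \<alpha> \<alpha>]) (simp_all add: hom2_def cells \<alpha>(3))
  moreover have "(\<mu> \<lhd> T1 T (unit T U)) \<cdot> (\<alpha> \<rhd> T2 T \<upsilon>) = Id2 K \<alpha>"
    by (rule marked_cells_eq[OF terminal, of _ \<alpha> \<alpha>]) (simp_all add: hom2_def cells \<alpha>(3))
  moreover have "(\<mu> \<lhd> mult T (T0 T U)) \<cdot> (\<mu> \<lhd> T1 T (T1 T \<alpha>))
      = (\<mu> \<lhd> T1 T (mult T U)) \<cdot> (\<alpha> \<rhd> T2 T \<mu>)"
    by (rule marked_cells_eq[OF terminal, of _ "\<alpha> \<odot> T1 T \<alpha> \<odot> T1 T (T1 T \<alpha>)"
          "\<alpha> \<odot> mult T U \<odot> mult T (T0 T U)"])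
      (simp_all add: hom2_def cells \<alpha>(3))
  ultimately show ?thesis
    using \<alpha> \<upsilon> \<mu> by auto
qed

text \<open>
  The two coherence laws compare cells out of \<open>f\<close> and out of \<open>\<beta> \<circ> T\<beta> \<circ> TTf\<close>, where \<open>\<beta>\<close> is the
  structure map of the target.  Both of these 1-cells are marked.
\<close>

lemma lax_morphism_into_U:
  assumes A: "lax_algebra K T A" and B: "lax_algebra K T B" "carrier B = U" "struct B \<in> Marked K"
    and f: "f \<in> hom1 K (carrier A) U" "f \<in> Marked K"
    and f': "f' \<in> hom2 K (struct B \<odot> T1 T f) (f \<odot> struct A)"
  shows "lax_morphism K T (LaxMor A B f f')"
proof -
  obtain X \<alpha> \<upsilon>\<^sub>A \<mu>\<^sub>A where AX: "A = LaxAlgebra X \<alpha> \<upsilon>\<^sub>A \<mu>\<^sub>A" by (cases A)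
  obtain \<beta> \<upsilon>\<^sub>B \<mu>\<^sub>B where BX: "B = LaxAlgebra U \<beta> \<upsilon>\<^sub>B \<mu>\<^sub>B" using B(2) by (cases B) auto
  have \<beta>: "\<beta> \<in> Marked K" using B(3) BX by simp
  have ty: "X \<in> Ob K" "\<alpha> \<in> Mor K" "Dom K \<alpha> = T0 T X" "Cod K \<alpha> = X"
      "\<beta> \<in> Mor K" "Dom K \<beta> = T0 T U" "Cod K \<beta> = U"
      "f \<in> Mor K" "Dom K f = X" "Cod K f = U"
      "\<upsilon>\<^sub>A \<in> Cell K" "Src K \<upsilon>\<^sub>A = Id1 K X" "Tgt K \<upsilon>\<^sub>A = \<alpha> \<odot> unit T X"
      "\<mu>\<^sub>A \<in> Cell K" "Src K \<mu>\<^sub>A = \<alpha> \<odot> T1 T \<alpha>" "Tgt K \<mu>\<^sub>A = \<alpha> \<odot> mult T X"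
      "\<upsilon>\<^sub>B \<in> Cell K" "Src K \<upsilon>\<^sub>B = Id1 K U" "Tgt K \<upsilon>\<^sub>B = \<beta> \<odot> unit T U"
      "\<mu>\<^sub>B \<in> Cell K" "Src K \<mu>\<^sub>B = \<beta> \<odot> T1 T \<beta>" "Tgt K \<mu>\<^sub>B = \<beta> \<odot> mult T U"
      "f' \<in> Cell K" "Src K f' = \<beta> \<odot> T1 T f" "Tgt K f' = f \<odot> \<alpha>"
    using A B f f' unfolding AX BX by (auto simp: hom1_def hom2_def)
  have "f \<rhd> \<upsilon>\<^sub>A = (f' \<lhd> unit T X) \<cdot> (\<upsilon>\<^sub>B \<lhd> f)"
    by (rule marked_cells_eq[OF terminal, of _ f "f \<odot> \<alpha> \<odot> unit T X"])
      (simp_all add: hom2_def ty f(2))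
  moreover have "(f \<rhd> \<mu>\<^sub>A) \<cdot> (f' \<lhd> T1 T \<alpha>) \<cdot> (\<beta> \<rhd> T2 T f')
      = (f' \<lhd> mult T X) \<cdot> (\<mu>\<^sub>B \<lhd> T1 T (T1 T f))"
    by (rule marked_cells_eq[OF terminal, of _ "\<beta> \<odot> T1 T \<beta> \<odot> T1 T (T1 T f)" "f \<odot> \<alpha> \<odot> mult T X"])
      (simp_all add: hom2_def ty \<beta> f(2))
  ultimately show ?thesis
    using A B(1) f(1) f' unfolding AX BX by simp
qed

text \<open>
  The comparison cell of a lax morphism has source \<open>\<beta> \<circ> Tf\<close>, with \<open>\<beta>\<close> the structure map of the
  target; when \<open>f\<close> and \<open>\<beta>\<close> are marked, so is this source, and the comparison cell is forced.
\<close>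

lemma lax_mor_eqI:
  assumes F: "lax_morphism K T F" "mcod F = B" and G: "lax_morphism K T G" "mcod G = B"
    and B: "carrier B = U" "struct B \<in> Marked K"
    and "mdom F = mdom G" "und F = und G" "und F \<in> Marked K"
  shows "F = G"
proof -
  note tyB = lax_algebraD[OF lax_morphismD(2)[OF F(1)]]
  have "bar F = bar G"
    by (rule marked_cells_eq[OF terminal lax_morphismD(4)[OF F(1)]])
      (use assms lax_morphismD[OF F(1)] lax_morphismD[OF G(1)] tyB in \<open>auto simp: hom1_def\<close>)
  then show ?thesis using assms by (simp add: lax_mor.expand)
qed

text \<open>
  The law of a \<open>T\<close>-2-morphism out of a marked \<open>f\<close> is an equality of cells out of \<open>\<beta> \<circ> Tf\<close>,
  which is marked when the structure map \<open>\<beta>\<close> of the target is.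
\<close>

lemma lax_two_morphism_into_U:
  assumes F: "lax_morphism K T F" "und F \<in> Marked K" and G: "lax_morphism K T G"
    and eq: "mdom F = mdom G" "mcod F = mcod G"
    and B: "carrier (mcod F) = U" "struct (mcod F) \<in> Marked K"
    and \<phi>: "\<phi> \<in> hom2 K (und F) (und G)"
  shows "lax_two_morphism K T (LaxCell F G \<phi>)"
proof -
  let ?\<alpha> = "struct (mdom F)" and ?\<beta> = "struct (mcod F)"
  note ty = lax_morphismD(3,4)[OF F(1)] lax_morphismD(3,4)[OF G] \<phi>
    lax_algebraD[OF lax_morphismD(1)[OF F(1)]] lax_algebraD[OF lax_morphismD(2)[OF F(1)]]
  have "(\<phi> \<lhd> ?\<alpha>) \<cdot> bar F = bar G \<cdot> (?\<beta> \<rhd> T2 T \<phi>)"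
    by (rule marked_cells_eq[OF terminal, of _ "?\<beta> \<odot> T1 T (und F)" "und G \<odot> ?\<alpha>"])
      (use ty eq B F(2) in \<open>simp_all add: hom1_def hom2_def\<close>)
  then show ?thesis using F G eq \<phi> by simp
qed

text \<open>
  Initiality of marked 1-cells into \<open>U\<close> lifts from the base to lax algebras, together with its
  consequence on invertibility.
\<close>

lemma LaxAlg_cells_into_U:
  assumes F: "lax_morphism K T F" "und F \<in> Marked K" and G: "lax_morphism K T G"
    and eq: "mdom F = mdom G" "mcod F = mcod G"
    and B: "carrier (mcod F) = U" "struct (mcod F) \<in> Marked K"
  shows "hom2 (LaxAlg K T) F G = {LaxCell F G (THE \<phi>. \<phi> \<in> hom2 K (und F) (und G))}"
proof -
  have ex1: "\<exists>!\<phi>. \<phi> \<in> hom2 K (und F) (und G)"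
    using lax_morphismD(3)[OF F(1)] lax_morphismD(3)[OF G] eq B F(2)
    by (intro marked_initial[OF terminal]) (auto simp: hom1_def)
  have "\<Phi> \<in> hom2 (LaxAlg K T) F G \<longleftrightarrow> \<Phi> = LaxCell F G (THE \<phi>. \<phi> \<in> hom2 K (und F) (und G))" for \<Phi>
  proof
    assume "\<Phi> \<in> hom2 (LaxAlg K T) F G"
    then have "csrc \<Phi> = F" "ctgt \<Phi> = G" "ucell \<Phi> \<in> hom2 K (und F) (und G)"
      by (cases \<Phi>; auto simp: hom2_LaxAlg_iff)+
    then show "\<Phi> = LaxCell F G (THE \<phi>. \<phi> \<in> hom2 K (und F) (und G))"
      using the1_equality[OF ex1] by (simp add: lax_cell.expand)
  next
    assume "\<Phi> = LaxCell F G (THE \<phi>. \<phi> \<in> hom2 K (und F) (und G))"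
    then show "\<Phi> \<in> hom2 (LaxAlg K T) F G"
      using lax_two_morphism_into_U[OF F G eq B theI'[OF ex1]]
      by (simp add: hom2_LaxAlg_iff del: lax_two_morphism.simps)
  qed
  then show ?thesis by blast
qed

lemma LaxAlg_cells_into_U_invertible:
  assumes \<Phi>: "\<Phi> \<in> hom2 (LaxAlg K T) F G" and mk: "und F \<in> Marked K" "und G \<in> Marked K"
    and B: "carrier (mcod F) = U" "struct (mcod F) \<in> Marked K"
  shows "invertible2 (LaxAlg K T) \<Phi>"
proof -
  obtain \<phi> where \<Phi>': "\<Phi> = LaxCell F G \<phi>" and F: "lax_morphism K T F" and G: "lax_morphism K T G"
    and eq: "mdom F = mdom G" "mcod F = mcod G" and \<phi>: "\<phi> \<in> hom2 K (und F) (und G)"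
    using \<Phi> by (cases \<Phi>) (auto simp: hom2_LaxAlg_iff)
  have "Cod K (und F) = U"
    using lax_morphismD(3)[OF F] B by (simp add: hom1_def)
  then have "invertible2 K \<phi>"
    using marked_cells_invertible[OF terminal \<phi> mk] by simp
  then obtain \<psi> where \<psi>: "\<psi> \<in> hom2 K (und G) (und F)"
    and inv: "\<psi> \<cdot> \<phi> = Id2 K (und F)" "\<phi> \<cdot> \<psi> = Id2 K (und G)"
    using \<phi> by (auto simp: invertible2_def hom2_def)
  have "lax_two_morphism K T (LaxCell G F \<psi>)"
    by (rule lax_two_morphism_into_U[OF G mk(2) F]) (use eq B \<psi> in auto)
  then show ?thesis
    using \<Phi> inv unfolding invertible2_def
    by (intro conjI bexI[of _ "LaxCell G F \<psi>"])
      (auto simp: hom2_LaxAlg_iff \<Phi>', auto simp: LaxAlg_def hom2_def)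
qed

lemma lax_morphism_Id:
  assumes A: "lax_algebra K T A" "carrier A = U" "struct A \<in> Marked K"
  shows "lax_morphism K T (LaxMor A A (Id1 K U) (Id2 K (struct A)))"
  using lax_algebraD[OF A(1)] A
  by (intro lax_morphism_into_U) (auto simp: hom1_def hom2_def)

text \<open>
  The chosen 1-cell out of an algebra is \<open>d\<close> of its carrier with the unique comparison cell.  If the
  algebra is codotted, its structure map is marked as well, so both ends of the comparison cell are
  marked and it is invertible: the chosen 1-cell is then tight.
\<close>

lemma codotted_lax_terminal_LaxAlg:
  assumes B: "lax_algebra K T B" "carrier B = U" "struct B \<in> Marked K"
    and U_cod: "U \<in> Codotted K" and d_tight: "\<And>X. X \<in> Codotted K \<Longrightarrow> d X \<in> Tight K"
  shows "codotted_lax_terminal (LaxAlg K T) B"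
proof -
  have d: "d X \<in> hom1 K X U" "d X \<in> Marked K" if "X \<in> Ob K" for X
    using terminal that by (auto simp: marked_lax_terminal_data_def)
  have ex_bar: "\<exists>b. b \<in> hom2 K (struct B \<odot> T1 T (d (carrier A))) (d (carrier A) \<odot> struct A)"
    if "lax_algebra K T A" for A
    using marked_initial[OF terminal, of "struct B \<odot> T1 T (d (carrier A))" "d (carrier A) \<odot> struct A"]
      lax_algebraD[OF that] lax_algebraD[OF B(1)] B d[of "carrier A"]
    by (auto simp: hom1_def)
  define b where "b A = (SOME b. b \<in> hom2 K (struct B \<odot> T1 T (d (carrier A))) (d (carrier A) \<odot> struct A))"
    for A :: "('o, 'm, 'c) lax_alg"
  have b: "b A \<in> hom2 K (struct B \<odot> T1 T (d (carrier A))) (d (carrier A) \<odot> struct A)"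
    if "lax_algebra K T A" for A
    unfolding b_def by (rule someI_ex[OF ex_bar[OF that]])
  define D where "D A = LaxMor A B (d (carrier A)) (b A)" for A
  have D_sel [simp]: "mdom (D A) = A" "mcod (D A) = B" "und (D A) = d (carrier A)" "bar (D A) = b A" for A
    by (simp_all add: D_def)
  have D: "lax_morphism K T (D A)" if "lax_algebra K T A" for A
    unfolding D_def using that d lax_algebraD[OF that] B b by (intro lax_morphism_into_U) auto
  define \<Delta> where "\<Delta> F = (THE \<Phi>. \<Phi> \<in> hom2 (LaxAlg K T) (D (mdom F)) (lax_mor_comp K T (D (mcod F)) F))" for F
  have comp: "lax_morphism K T (lax_mor_comp K T (D (mcod F)) F)" if "lax_morphism K T F" for F
    using that by (intro lax_mor_comp_lax_morphism D lax_morphismD(2)) auto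
  have \<Delta>: "hom2 (LaxAlg K T) (D (mdom F)) (lax_mor_comp K T (D (mcod F)) F) = {\<Delta> F}"
    if F: "lax_morphism K T F" for F
  proof -
    have "\<exists>\<Phi>. hom2 (LaxAlg K T) (D (mdom F)) (lax_mor_comp K T (D (mcod F)) F) = {\<Phi>}"
      using LaxAlg_cells_into_U[OF D[OF lax_morphismD(1)[OF F]] _ comp[OF F]]
        d[OF lax_algebraD(1)[OF lax_morphismD(1)[OF F]]] B
      by (auto simp: lax_mor_comp_def)
    then show ?thesis unfolding \<Delta>_def by auto
  qed
  have data: "marked_lax_terminal_data (LaxAlg K T) B D \<Delta>"
    unfolding marked_lax_terminal_data_def
  proof (intro conjI ballI)
    show "B \<in> Ob (LaxAlg K T)" using B by (simp add: LaxAlg_def)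
  next
    fix A assume "A \<in> Ob (LaxAlg K T)"
    then have A: "lax_algebra K T A" by (simp add: LaxAlg_def)
    show "D A \<in> hom1 (LaxAlg K T) A B" "D A \<in> Marked (LaxAlg K T)"
      using D[OF A] d[OF lax_algebraD(1)[OF A]] by (simp_all add: LaxAlg_def hom1_def)
  next
    fix F assume "F \<in> Mor (LaxAlg K T)"
    then have "lax_morphism K T F" by (simp add: LaxAlg_def)
    then show "hom2 (LaxAlg K T) (D (Dom (LaxAlg K T) F)) (D (Cod (LaxAlg K T) F) \<odot>\<^bsub>LaxAlg K T\<^esub> F) = {\<Delta> F}"
      using \<Delta> by (simp add: LaxAlg_def)
  next
    fix F assume "F \<in> Marked (LaxAlg K T)"
    then have F: "lax_morphism K T F" "und F \<in> Marked K" by (simp_all add: LaxAlg_def)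
    note ty = lax_morphismD(3)[OF F(1)]
      lax_algebraD(1)[OF lax_morphismD(1)[OF F(1)]] lax_algebraD(1)[OF lax_morphismD(2)[OF F(1)]]
    show "invertible2 (LaxAlg K T) (\<Delta> F)"
    proof (rule LaxAlg_cells_into_U_invertible)
      show "\<Delta> F \<in> hom2 (LaxAlg K T) (D (mdom F)) (lax_mor_comp K T (D (mcod F)) F)"
        using \<Delta>[OF F(1)] by simp
      show "und (lax_mor_comp K T (D (mcod F)) F) \<in> Marked K"
        using ty d F(2) by (auto simp: lax_mor_comp_def hom1_def)
    qed (use B d ty in auto)
  next
    have "hom2 (LaxAlg K T) (D B) (LaxMor B B (Id1 K U) (Id2 K (struct B))) \<noteq> {}"
      using LaxAlg_cells_into_U[OF D[OF B(1)] _ lax_morphism_Id[OF B]] B d[of U] by simp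
    then obtain \<iota> where \<iota>: "\<iota> \<in> hom2 (LaxAlg K T) (D B) (LaxMor B B (Id1 K U) (Id2 K (struct B)))"
      by blast
    moreover have "invertible2 (LaxAlg K T) \<iota>"
      by (rule LaxAlg_cells_into_U_invertible[OF \<iota>]) (use B d[of U] in auto)
    ultimately show "\<exists>\<iota>\<in>hom2 (LaxAlg K T) (D B) (Id1 (LaxAlg K T) B). invertible2 (LaxAlg K T) \<iota>"
      using B by (auto simp: LaxAlg_def)
  qed
  have "D A \<in> Tight (LaxAlg K T)" if "A \<in> Codotted (LaxAlg K T)" for A
  proof -
    have A: "lax_algebra K T A" "carrier A \<in> Codotted K" "struct A \<in> Marked K"
      using that by (simp_all add: LaxAlg_def)
    have "invertible2 K (b A)"
      by (rule marked_cells_invertible[OF terminal b[OF A(1)]])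
        (use A B d[of "carrier A"] lax_algebraD[OF A(1)] lax_algebraD[OF B(1)] in \<open>auto simp: hom1_def\<close>)
    then show ?thesis using D[OF A(1)] d_tight[OF A(2)] by (simp add: LaxAlg_def)
  qed
  then show ?thesis
    unfolding codotted_lax_terminal_def using data B U_cod by (auto simp: LaxAlg_def)
qed

text \<open>
  The unique cell between the two structure maps, in either direction, is invertible and makes the
  identity of \<open>U\<close> a pseudo-morphism.  Both composites are identities because a lax morphism over a marked 1-cell into
  \<open>U\<close> is determined by that 1-cell.
\<close>

lemma tight_iso_of_algebras_on_U:
  assumes A: "lax_algebra K T A" "carrier A = U" "struct A \<in> Marked K"
    and B: "lax_algebra K T B" "carrier B = U" "struct B \<in> Marked K"
  shows "\<exists>F. tight_iso (LaxAlg K T) A B F \<and> und F = Id1 K U"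
proof -
  have step: "\<exists>F. lax_morphism K T F \<and> mdom F = A \<and> mcod F = B \<and> und F = Id1 K U \<and> F \<in> Tight (LaxAlg K T)"
    if A: "lax_algebra K T A" "carrier A = U" "struct A \<in> Marked K"
    and B: "lax_algebra K T B" "carrier B = U" "struct B \<in> Marked K" for A B
  proof -
    note ty = lax_algebraD(2)[OF A(1)] lax_algebraD(2)[OF B(1)]
    obtain \<theta> where \<theta>: "\<theta> \<in> hom2 K (struct B) (struct A)"
      using marked_initial[OF terminal, of "struct B" "struct A"] ty A B by (auto simp: hom1_def)
    have "invertible2 K \<theta>"
      by (rule marked_cells_invertible[OF terminal \<theta>]) (use ty A B in \<open>auto simp: hom1_def\<close>)
    moreover have "lax_morphism K T (LaxMor A B (Id1 K U) \<theta>)"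
      using ty A B \<theta> by (intro lax_morphism_into_U) (auto simp: hom1_def)
    ultimately show ?thesis
      by (intro exI[of _ "LaxMor A B (Id1 K U) \<theta>"]) (simp add: LaxAlg_def)
  qed
  obtain F where F: "lax_morphism K T F" "mdom F = A" "mcod F = B" "und F = Id1 K U" "F \<in> Tight (LaxAlg K T)"
    using step[OF A B] by blast
  obtain G where G: "lax_morphism K T G" "mdom G = B" "mcod G = A" "und G = Id1 K U" "G \<in> Tight (LaxAlg K T)"
    using step[OF B A] by blast
  have "lax_mor_comp K T G F = LaxMor A A (Id1 K U) (Id2 K (struct A))"
    by (rule lax_mor_eqI[OF lax_mor_comp_lax_morphism[OF F(1) G(1)] _ lax_morphism_Id[OF A], of A])
      (use F G A in \<open>auto simp: lax_mor_comp_def\<close>)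
  moreover have "lax_mor_comp K T F G = LaxMor B B (Id1 K U) (Id2 K (struct B))"
    by (rule lax_mor_eqI[OF lax_mor_comp_lax_morphism[OF G(1) F(1)] _ lax_morphism_Id[OF B], of B])
      (use F G B in \<open>auto simp: lax_mor_comp_def\<close>)
  moreover have "F \<in> hom1 (LaxAlg K T) A B" "G \<in> hom1 (LaxAlg K T) B A"
    using F G by (simp_all add: hom1_def LaxAlg_def)
  ultimately have "tight_iso (LaxAlg K T) A B F"
    unfolding tight_iso_def using F(5) G(5) A(2) B(2)
    by (intro conjI bexI[of _ G]) (simp_all add: LaxAlg_def)
  then show ?thesis using F by blast
qed

end

section \<open>Existence and uniqueness of the terminal lax algebra\<close>

theorem theorem6p4:
  fixes K :: "('o, 'm, 'c) codotted_two_cat"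
    and T :: "('o, 'm, 'c) two_monad"
    and U :: 'o
  assumes "codotted_two_category K"
    and "codotted_lax_terminal K U"
    and "marked_enhanced_two_monad K T"
    and "T0 T U \<in> Codotted K"
  shows "(\<exists>A. lax_algebra K T A \<and> carrier A = U \<and> codotted_lax_terminal (LaxAlg K T) A) \<and>
         (\<forall>A B. lax_algebra K T A \<and> carrier A = U \<and> codotted_lax_terminal (LaxAlg K T) A \<and>
                lax_algebra K T B \<and> carrier B = U \<and> codotted_lax_terminal (LaxAlg K T) B \<longrightarrow>
                (\<exists>F. tight_iso (LaxAlg K T) A B F \<and> und F = Id1 K U))"
proof -
  obtain d \<delta> where U: "U \<in> Codotted K" "marked_lax_terminal_data K U d \<delta>"
    and d_tight: "\<And>X. X \<in> Codotted K \<Longrightarrow> d X \<in> Tight K"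
    using assms(2) by (auto simp: codotted_lax_terminal_def)
  interpret lax_terminal_monad K T U d \<delta>
    using assms(1,3) U(2)
    by (intro lax_terminal_monad.intro codotted_monad.intro lax_terminal_monad_axioms.intro)
  have \<alpha>: "d (T0 T U) \<in> hom1 K (T0 T U) U" "d (T0 T U) \<in> Marked K"
    using U(2) T0_in[OF U_Ob] by (simp_all add: marked_lax_terminal_data_def)
  obtain \<upsilon> \<mu> where A: "lax_algebra K T (LaxAlgebra U (d (T0 T U)) \<upsilon> \<mu>)"
    using lax_algebra_on_U[OF \<alpha>(1) d_tight[OF assms(4)] \<alpha>(2)] by blast
  have "codotted_lax_terminal (LaxAlg K T) (LaxAlgebra U (d (T0 T U)) \<upsilon> \<mu>)"
    using codotted_lax_terminal_LaxAlg[OF A _ _ U(1) d_tight] \<alpha>(2) by simp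
  moreover have "struct A \<in> Marked K" if "codotted_lax_terminal (LaxAlg K T) A" for A
    using that by (simp add: codotted_lax_terminal_def LaxAlg_def)
  ultimately show ?thesis
    using A tight_iso_of_algebras_on_U by (metis lax_alg.sel(1))
qed

end
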